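(* Let $m\ge1$ and $r\ge 1$ be integers, let $Q=\{0,1,\dots,r\}^m$ and let $\varrho=(r,\dots,r)$ be its maximum element. (a) Let $P$ be a permutation array of width $r$ and dimension $m$. Then the function $\mathbf r_P:Q\to\mathbb Z$ defined by $\mathbf r_P(a)=r+1-\mathrm{rank}(P[a])$ is the rank function of a simple matricube $\mathscr M_P$ with ground set $Q$. This matricube has rank $r$ if the position $\varrho$ is dotted in $P$, and rank $r+1$ if it is not. The set of flats of $\mathbf r_P$ is precisely the union of the set of dotted positions of $P$, the set $R(P)$ of redundant positions of $P$, and $\{\varrho\}$. (b) Conversely, let $\mathscr M$ be a simple matricube of rank $r$ or $r+1$ with ground set $Q$. Let $P_{\mathscr M}$ be the dot array on $Q$ whose dotted positions are the flats $a\neq\varrho$ of $\mathscr M$, together with $\varrho$ in the case where $\mathscr M$ has rank $r$. Then $P:=P_{\mathscr M}\setminus R(P_{\mathscr M})$ (the dot array obtained from $P_{\mathscr M}$ by undotting all redundant positions) is a permutation array of width $r$ and dimension $m$.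
   Context: $Q$ is ordered coordinatewise, $x\preceq y$ iff $x_j\le y_j$ for all $j$; $\vee$ and $\wedge$ are the coordinatewise maximum and minimum; $e_i$ is the $i$-th unit vector. A matricube with ground set $Q$ is given by a function $\mathbf r:Q\to\mathbb Z$ (its rank function) such that: (R1) $\mathbf r(0)=0$ and $\mathbf r(t\,e_i)-\mathbf r((t-1)e_i)\le 1$ for all $1\le i\le m$ and $1\le t\le r$; (R2) $x\preceq y$ implies $\mathbf r(x)\le\mathbf r(y)$; (R3) $\mathbf r(x)+\mathbf r(y)\ge \mathbf r(x\vee y)+\mathbf r(x\wedge y)$. Its rank is $\mathbf r(\varrho)$. It is simple if $r>0$ and $\mathbf r(t\,e_i)=t$ for all $i$ and $t\in\{0,\dots,r\}$. A flat is a point $a\in Q$ such that $\mathbf r(a+e_i)=\mathbf r(a)+1$ for every $i$ with $a+e_i\in Q$. A dot array $P$ on $Q$ is an array of shape $Q$ in which some positions (a subset of $Q$) are dotted. For $x\in Q$, $P[x]$ is the upper principal subarray consisting of the positions $y\succeq x$, with the dots of $P$ there. For $j\in\{1,\dots,m\}$, $\mathrm{rank}_j$ of a dot array is the number of integers $t$ such that there is at least one dot in some position with $j$-th coordinate equal to $t$. A dot array is rankable if $\mathrm{rank}_1=\dots=\mathrm{rank}_m$; the common value is its rank. $P$ is totally rankable if $P[x]$ is rankable for every $x\in Q$. A position $x$ is redundant in $P$ if there exist $k\ge2$ and dotted positions $y_1,\dots,y_k\ne x$ such that each $y_l$ has at least one coordinate in common with $x$ (that is, $(y_l)_j=x_j$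 for some $j$) and $x=y_1\wedge\dots\wedge y_k$; $x$ itself need not be dotted. $R(P)$ denotes the set of redundant positions of $P$. A redundant dot is a redundant position that is dotted. A permutation array of width $r$ and dimension $m$ is a totally rankable dot array on $Q$, of rank $r+1$, with no redundant dots. *)

theory Defs
  imports Main
begin

text \<open>
  The coordinates are indexed by a nonempty finite type \<open>'m\<close>, so the dimension is
  \<open>m = CARD('m) \<ge> 1\<close>. The coordinatewise order, maximum and minimum are the library's
  \<open>\<le>\<close>, \<open>sup\<close>, \<open>inf\<close> on functions. The point \<open>t e\<^sub>i\<close> is written
  \<open>(\<lambda>_. 0)(i := t)\<close> and \<open>a + e\<^sub>i\<close> is written \<open>a(i := a i + 1)\<close>.
\<close>

type_synonym 'm pos = "'m \<Rightarrow> nat"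

definition grid :: "nat \<Rightarrow> 'm::finite pos set" where
  "grid r = {x. \<forall>j. x j \<le> r}"

definition top_pos :: "nat \<Rightarrow> 'm::finite pos" where
  "top_pos r = (\<lambda>_. r)"


subsection \<open>Matricubes\<close>

text \<open>
  A matricube is represented by its rank function \<open>\<rho>\<close>; only the values of \<open>\<rho>\<close> on the
  grid matter.
\<close>

definition matricube :: "nat \<Rightarrow> ('m::finite pos \<Rightarrow> int) \<Rightarrow> bool" where
  "matricube r \<rho> \<longleftrightarrow>
     \<rho> (\<lambda>_. 0) = 0 \<and>
     (\<forall>i. \<forall>t\<in>{1..r}. \<rho> ((\<lambda>_. 0)(i := t)) - \<rho> ((\<lambda>_. 0)(i := t - 1)) \<le> 1) \<and>
     (\<forall>x\<in>grid r. \<forall>y\<in>grid r. x \<le> y \<longrightarrow> \<rho> x \<le> \<rho> y) \<and>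
     (\<forall>x\<in>grid r. \<forall>y\<in>grid r. \<rho> x + \<rho> y \<ge> \<rho> (sup x y) + \<rho> (inf x y))"

definition matricube_rank :: "nat \<Rightarrow> ('m::finite pos \<Rightarrow> int) \<Rightarrow> int" where
  "matricube_rank r \<rho> = \<rho> (top_pos r)"

definition simple_matricube :: "nat \<Rightarrow> ('m::finite pos \<Rightarrow> int) \<Rightarrow> bool" where
  "simple_matricube r \<rho> \<longleftrightarrow>
     matricube r \<rho> \<and> r > 0 \<and> (\<forall>i. \<forall>t\<in>{0..r}. \<rho> ((\<lambda>_. 0)(i := t)) = int t)"

definition flats :: "nat \<Rightarrow> ('m::finite pos \<Rightarrow> int) \<Rightarrow> 'm pos set" where
  "flats r \<rho> =
     {a \<in> grid r. \<forall>i. a(i := a i + 1) \<in> grid r \<longrightarrow> \<rho> (a(i := a i + 1)) = \<rho> a + 1}"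


subsection \<open>Dot arrays\<close>

text \<open>A dot array is represented by its set of dotted positions, a subset of the grid.\<close>

definition upper_subarray :: "'m::finite pos set \<Rightarrow> 'm pos \<Rightarrow> 'm pos set" where
  "upper_subarray P x = {y \<in> P. x \<le> y}"

definition coord_rank :: "'m::finite \<Rightarrow> 'm pos set \<Rightarrow> nat" where
  "coord_rank j P = card {t. \<exists>y\<in>P. y j = t}"

definition rankable :: "'m::finite pos set \<Rightarrow> bool" where
  "rankable P \<longleftrightarrow> (\<forall>i j. coord_rank i P = coord_rank j P)"

text \<open>Meaningful only for rankable arrays.\<close>

definition array_rank :: "'m::finite pos set \<Rightarrow> nat" where
  "array_rank P = (THE n. \<forall>j. coord_rank j P = n)"

definition totally_rankable :: "nat \<Rightarrow> 'm::finite pos set \<Rightarrow> bool" where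
  "totally_rankable r P \<longleftrightarrow> (\<forall>x\<in>grid r. rankable (upper_subarray P x))"

definition redundant_positions :: "nat \<Rightarrow> 'm::finite pos set \<Rightarrow> 'm pos set" where
  "redundant_positions r P =
     {x \<in> grid r. \<exists>k\<ge>2. \<exists>y :: nat \<Rightarrow> 'm pos.
        (\<forall>l\<in>{1..k}. y l \<in> P \<and> y l \<noteq> x \<and> (\<exists>j. y l j = x j)) \<and>
        x = Inf_fin (y ` {1..k})}"

definition permutation_array :: "nat \<Rightarrow> 'm::finite pos set \<Rightarrow> bool" where
  "permutation_array r P \<longleftrightarrow>
     P \<subseteq> grid r \<and> totally_rankable r P \<and> array_rank P = r + 1 \<and>
     P \<inter> redundant_positions r P = {}"


subsection \<open>Passing between the two\<close>

definition rank_fun_of_array :: "nat \<Rightarrow> 'm::finite pos set \<Rightarrow> 'm pos \<Rightarrow> int" where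
  "rank_fun_of_array r P a = int r + 1 - int (array_rank (upper_subarray P a))"

definition array_of_matricube :: "nat \<Rightarrow> ('m::finite pos \<Rightarrow> int) \<Rightarrow> 'm pos set" where
  "array_of_matricube r \<rho> =
     (flats r \<rho> - {top_pos r}) \<union> (if matricube_rank r \<rho> = int r then {top_pos r} else {})"

end

theory Submission
  imports Defs
begin

text \<open>
  Both directions rest on one picture. Call the face of \<open>P[a]\<close> in direction \<open>j\<close> the set of
  positions \<open>y \<succeq> a\<close> with \<open>y\<^sub>j = a\<^sub>j\<close>. Passing from \<open>P[a]\<close> to \<open>P[a + e\<^sub>j]\<close> removes exactly this
  face, so \<open>rank\<^sub>j\<close> drops by one if the face carries a dot and is unchanged otherwise
  (\<open>coord_rank_step\<close>). Hence the rank function \<open>\<rho>\<close> of a totally rankable array obeys one rule: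
  it grows by one from \<open>a\<close> to \<open>a + e\<^sub>j\<close> if the face at \<open>a\<close> in direction \<open>j\<close> carries a dot,
  and otherwise not at all.

  From arrays to matricubes: if \<open>a \<preceq> b\<close> and \<open>a\<^sub>j = b\<^sub>j\<close>, the face at \<open>b\<close> lies in the face
  at \<open>a\<close>, so the increments of \<open>\<rho>\<close> are diminishing, which is submodularity
  (\<open>submodular_of_diminishing_increments\<close>). A flat \<open>a\<close> other than the top is a position all of whose
  relevant faces are dotted: either \<open>a\<close> is itself dotted, or the dots on its faces exhibit it as
  a redundant position, because redundancy of \<open>x\<close> just says that every face at \<open>x\<close> carries a dot
  other than \<open>x\<close> (\<open>redundant_positions_iff\<close>).

  From matricubes to arrays: if \<open>\<rho>\<close> grows from \<open>a\<close> to \<open>a + e\<^sub>j\<close>, then a maximal position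
  above \<open>a\<close> with the same value of \<open>\<rho>\<close> is a flat, and it lies on the face at \<open>a\<close> in
  direction \<open>j\<close>; conversely a flat on that face forces growth at \<open>a\<close> by submodularity. The same
  argument on the boundary \<open>a\<^sub>j = r\<close>, where \<open>\<rho> a \<in> {r, r + 1}\<close>, explains the
  special treatment of the top position. Undotting redundant positions changes no rank, since a
  maximal dot of a face is never redundant (\<open>has_dot_on_face_remove_redundant\<close>). Thus the array
  obeys the rule above, and summing along direction \<open>j\<close> gives \<open>rank\<^sub>j P[a] = r + 1 - \<rho> a\<close>
  for every \<open>j\<close>.
\<close>

section \<open>The grid\<close>

lemma finite_grid: "finite (grid r :: 'm::finite pos set)"
proof -
  have "finite {f :: 'm pos. \<forall>x. (x \<in> UNIV \<longrightarrow> f x \<in> {..r}) \<and> (x \<notin> UNIV \<longrightarrow> f x = 0)}"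
    by (rule finite_set_of_finite_funs) auto
  then show ?thesis
    by (simp add: grid_def)
qed

lemma zero_in_grid: "(\<lambda>_. 0) \<in> grid r"
  by (simp add: grid_def)

lemma top_pos_in_grid: "top_pos r \<in> grid r"
  by (simp add: grid_def top_pos_def)

lemma grid_le_top_pos: "x \<in> grid r \<Longrightarrow> x \<le> top_pos r"
  by (simp add: grid_def top_pos_def le_fun_def)

lemma top_pos_maximal: "x \<in> grid r \<Longrightarrow> top_pos r \<le> x \<Longrightarrow> x = top_pos r"
  by (simp add: antisym grid_le_top_pos)

lemma grid_ne_topE:
  assumes "x \<in> grid r" "x \<noteq> top_pos r"
  obtains i where "x i < r"
proof -
  obtain i where "x i \<noteq> r"
    using assms(2) by (auto simp: top_pos_def fun_eq_iff)
  moreover have "x i \<le> r"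
    using assms(1) by (simp add: grid_def)
  ultimately show ?thesis
    using that[of i] by simp
qed

lemma step_in_grid_iff: "a \<in> grid r \<Longrightarrow> a(i := a i + 1) \<in> grid r \<longleftrightarrow> a i < r"
  by (auto simp: grid_def)

lemma axis_in_grid: "t \<le> r \<Longrightarrow> (\<lambda>_. 0)(i := t) \<in> grid r"
  by (simp add: grid_def)

lemma sup_in_grid: "x \<in> grid r \<Longrightarrow> y \<in> grid r \<Longrightarrow> sup x y \<in> grid r"
  by (simp add: grid_def)

lemma in_grid_le: "x \<le> y \<Longrightarrow> y \<in> grid r \<Longrightarrow> x \<in> grid r"
  unfolding grid_def le_fun_def using order_trans by blast

text \<open>
  One-step increments that shrink upwards add up to submodularity: walk from
  \<open>u\<close> up to \<open>x\<close> by unit steps and compare each with the corresponding step, possibly trivial,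
  of the walk from \<open>u \<squnion> w\<close> to \<open>x \<squnion> w\<close>.
\<close>

lemma increments_diminish_along_walk:
  fixes f :: "'m::finite pos \<Rightarrow> int"
  assumes mono: "\<And>x y. x \<in> grid r \<Longrightarrow> y \<in> grid r \<Longrightarrow> x \<le> y \<Longrightarrow> f x \<le> f y"
    and dim: "\<And>a b i. a \<in> grid r \<Longrightarrow> b \<in> grid r \<Longrightarrow> a \<le> b \<Longrightarrow> a i = b i \<Longrightarrow> b i < r \<Longrightarrow>
               f (b(i := b i + 1)) - f b \<le> f (a(i := a i + 1)) - f a"
    and x: "x \<in> grid r" and w: "w \<in> grid r"
  shows "u \<le> x \<Longrightarrow> f (sup x w) - f (sup u w) \<le> f x - f u"
proof (induction "\<Sum>j\<in>UNIV. x j - u j" arbitrary: u rule: less_induct)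
  case less
  show ?case
  proof (cases "u = x")
    case True
    then show ?thesis by simp
  next
    case False
    then obtain i where i: "u i < x i"
      using less.prems by (auto simp: fun_eq_iff le_fun_def le_less)
    let ?u = "u(i := u i + 1)"
    have ug: "u \<in> grid r"
      using in_grid_le[OF less.prems x] .
    have ir: "u i < r"
      using i x by (auto simp: grid_def intro: less_le_trans)
    have u'x: "?u \<le> x"
      using less.prems i by (simp add: le_fun_def)
    have u'g: "?u \<in> grid r"
      using in_grid_le[OF u'x x] .
    have "(\<Sum>j\<in>UNIV. x j - ?u j) < (\<Sum>j\<in>UNIV. x j - u j)"
      by (rule sum_strict_mono_ex1) (use i in auto)
    then have IH: "f (sup x w) - f (sup ?u w) \<le> f x - f ?u"
      using less.hyps u'x by blast
    have "f (sup ?u w) - f (sup u w) \<le> f ?u - f u"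
    proof (cases "u i < w i")
      case True
      then have "sup ?u w = sup u w"
        by (auto simp: fun_eq_iff sup_nat_def)
      moreover have "f u \<le> f ?u"
        by (rule mono[OF ug u'g]) (simp add: le_fun_def)
      ultimately show ?thesis by simp
    next
      case False
      then have eq: "sup ?u w = (sup u w)(i := sup u w i + 1)" and ui: "u i = sup u w i"
        by (auto simp: fun_eq_iff sup_nat_def)
      show ?thesis
        unfolding eq by (rule dim[OF ug sup_in_grid[OF ug w]]) (use ui ir in auto)
    qed
    with IH show ?thesis by linarith
  qed
qed

lemma submodular_of_diminishing_increments:
  fixes f :: "'m::finite pos \<Rightarrow> int"
  assumes mono: "\<And>x y. x \<in> grid r \<Longrightarrow> y \<in> grid r \<Longrightarrow> x \<le> y \<Longrightarrow> f x \<le> f y"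
    and dim: "\<And>a b i. a \<in> grid r \<Longrightarrow> b \<in> grid r \<Longrightarrow> a \<le> b \<Longrightarrow> a i = b i \<Longrightarrow> b i < r \<Longrightarrow>
               f (b(i := b i + 1)) - f b \<le> f (a(i := a i + 1)) - f a"
    and x: "x \<in> grid r" and y: "y \<in> grid r"
  shows "f (sup x y) + f (inf x y) \<le> f x + f y"
proof -
  have "f (sup x y) - f (sup (inf x y) y) \<le> f x - f (inf x y)"
    using increments_diminish_along_walk[of r f x y "inf x y"] mono dim x y by simp
  moreover have "sup (inf x y) y = y"
    by (simp add: sup_absorb2)
  ultimately show ?thesis by simp
qed


section \<open>Dotted faces\<close>

definition has_dot_on_face :: "'m::finite pos set \<Rightarrow> 'm pos \<Rightarrow> 'm \<Rightarrow> bool" where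
  "has_dot_on_face P a j \<longleftrightarrow> (\<exists>y\<in>P. a \<le> y \<and> y j = a j)"

lemma has_dot_on_face_antimono:
  "has_dot_on_face P b j \<Longrightarrow> a \<le> b \<Longrightarrow> a j = b j \<Longrightarrow> has_dot_on_face P a j"
  unfolding has_dot_on_face_def by (metis order_trans)

lemma finite_coord_values:
  assumes "P \<subseteq> grid r"
  shows "finite {t. \<exists>y\<in>upper_subarray P a. y j = t}"
proof (rule finite_subset)
  show "{t. \<exists>y\<in>upper_subarray P a. y j = t} \<subseteq> {..r}"
    using assms by (auto simp: upper_subarray_def grid_def)
qed simp

lemma step_le_iff:
  fixes a y :: "'m::finite pos"
  shows "a(j := a j + 1) \<le> y \<longleftrightarrow> a \<le> y \<and> y j \<noteq> a j"
proof
  assume le: "a(j := a j + 1) \<le> y"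
  have "a k \<le> y k" for k
    using le_funD[OF le, of k] by (cases "k = j") auto
  moreover have "y j \<noteq> a j"
    using le_funD[OF le, of j] by auto
  ultimately show "a \<le> y \<and> y j \<noteq> a j"
    by (simp add: le_fun_def)
next
  assume "a \<le> y \<and> y j \<noteq> a j"
  then show "a(j := a j + 1) \<le> y"
    by (simp add: le_fun_def Suc_le_eq le_neq_implies_less)
qed

lemma coord_rank_step:
  fixes P :: "'m::finite pos set"
  assumes P: "P \<subseteq> grid r"
  shows "coord_rank j (upper_subarray P a) =
           coord_rank j (upper_subarray P (a(j := a j + 1))) + (if has_dot_on_face P a j then 1 else 0)"
proof -
  let ?T = "\<lambda>a. {t. \<exists>y\<in>upper_subarray P a. y j = t}"
  let ?a = "a(j := a j + 1)"
  have eq: "?T a = ?T ?a \<union> (if has_dot_on_face P a j then {a j} else {})"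
    by (auto simp: upper_subarray_def has_dot_on_face_def step_le_iff[simplified] simp del: fun_upd_apply)
  have "a j \<notin> ?T ?a"
    by (auto simp: upper_subarray_def step_le_iff[simplified] simp del: fun_upd_apply)
  then have "card (?T a) = card (?T ?a) + (if has_dot_on_face P a j then 1 else 0)"
    unfolding eq using finite_coord_values[OF P, of ?a j]
    by (cases "has_dot_on_face P a j") (simp_all only: if_True if_False card_insert_disjoint
        Un_insert_right Un_empty_right add_0_right Suc_eq_plus1 not_False_eq_True)
  then show ?thesis
    unfolding coord_rank_def .
qed

lemma coord_rank_outside_grid:
  fixes P :: "'m::finite pos set"
  assumes "P \<subseteq> grid r" "r < a j"
  shows "coord_rank j (upper_subarray P a) = 0"
proof -
  have "\<not> a \<le> y" if "y \<in> P" for y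
  proof
    assume "a \<le> y"
    then have "a j \<le> y j"
      by (rule le_funD)
    moreover have "y j \<le> r"
      using that assms(1) by (auto simp: grid_def)
    ultimately show False
      using assms(2) by simp
  qed
  then have "upper_subarray P a = {}"
    by (auto simp: upper_subarray_def)
  then show ?thesis by (simp add: coord_rank_def)
qed

lemma coord_rank_upper_subarray_antimono:
  fixes P :: "'m::finite pos set"
  assumes "P \<subseteq> grid r" "x \<le> y"
  shows "coord_rank j (upper_subarray P y) \<le> coord_rank j (upper_subarray P x)"
  unfolding coord_rank_def
proof (rule card_mono[OF finite_coord_values[OF assms(1)]])
  show "{t. \<exists>z\<in>upper_subarray P y. z j = t} \<subseteq> {t. \<exists>z\<in>upper_subarray P x. z j = t}"
    using assms(2) by (auto simp: upper_subarray_def intro: order_trans)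
qed

lemma upper_subarray_zero: "upper_subarray P (\<lambda>_. 0) = P"
  by (auto simp: upper_subarray_def le_fun_def)

lemma array_rank_eq_coord_rank: "rankable P \<Longrightarrow> array_rank P = coord_rank j P"
  unfolding array_rank_def rankable_def by (rule the_equality) metis+

lemma coord_rank_upper_subarray_top:
  fixes P :: "'m::finite pos set"
  assumes "P \<subseteq> grid r"
  shows "coord_rank j (upper_subarray P (top_pos r)) = (if top_pos r \<in> P then 1 else 0)"
proof -
  have "upper_subarray P (top_pos r) = P \<inter> {top_pos r}"
    using assms top_pos_maximal by (fastforce simp: upper_subarray_def)
  then show ?thesis by (simp add: coord_rank_def)
qed


section \<open>Redundant positions\<close>

lemma Inf_fin_attained:
  fixes S :: "'m::finite pos set"
  assumes "finite S" "S \<noteq> {}"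
  shows "\<exists>y\<in>S. y j = Inf_fin S j"
  using assms
proof (induction rule: finite_ne_induct)
  case (insert x F)
  then show ?case by (auto simp: Inf_fin.insert inf_nat_def min_def)
qed simp

text \<open>
  Redundancy can be tested one face at a time. The minimum of the witnesses attains each
  coordinate of \<open>x\<close> at some witness; conversely one witness per direction has minimum \<open>x\<close>.
\<close>

lemma redundant_positions_iff:
  fixes P :: "'m::finite pos set"
  shows "x \<in> redundant_positions r P \<longleftrightarrow>
    x \<in> grid r \<and> (\<forall>j. \<exists>y\<in>P. x \<le> y \<and> y \<noteq> x \<and> y j = x j)"
proof
  assume "x \<in> redundant_positions r P"
  then obtain k and y :: "nat \<Rightarrow> 'm pos" where x: "x \<in> grid r" and k: "k \<ge> 2"
    and y: "\<forall>l\<in>{1..k}. y l \<in> P \<and> y l \<noteq> x" and xy: "x = Inf_fin (y ` {1..k})"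
    by (auto simp: redundant_positions_def)
  show "x \<in> grid r \<and> (\<forall>j. \<exists>y\<in>P. x \<le> y \<and> y \<noteq> x \<and> y j = x j)"
  proof (intro conjI allI x)
    fix j
    obtain l where l: "l \<in> {1..k}" "y l j = x j"
      using Inf_fin_attained[of "y ` {1..k}" j] k xy by auto
    then have "x \<le> y l"
      unfolding xy by (intro Inf_fin.coboundedI) auto
    then show "\<exists>y\<in>P. x \<le> y \<and> y \<noteq> x \<and> y j = x j"
      using l y by blast
  qed
next
  assume x: "x \<in> grid r \<and> (\<forall>j. \<exists>y\<in>P. x \<le> y \<and> y \<noteq> x \<and> y j = x j)"
  then obtain z where z: "\<And>j. z j \<in> P \<and> x \<le> z j \<and> z j \<noteq> x \<and> z j j = x j"
    by metis
  define n where "n = card (range z)"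
  obtain h where h: "bij_betw h {1..n} (range z)"
    using ex_bij_betw_nat_finite_1[of "range z"] by (auto simp: n_def)
  have n: "n \<ge> 1"
    unfolding n_def by (simp add: Suc_le_eq card_gt_0_iff)
  \<comment> \<open>The last witness is listed twice, so that there are at least two even if all directions share one.\<close>
  define y where "y l = h (min l n)" for l
  have im: "y ` {1..n + 1} = range z"
  proof -
    have "y ` {1..n + 1} = y ` {1..n} \<union> {y (n + 1)}"
      by (simp add: atLeastAtMostSuc_conv)
    also have "\<dots> = h ` {1..n} \<union> {h n}"
      by (auto simp: y_def)
    also have "\<dots> = range z"
      using h n by (auto simp: bij_betw_def)
    finally show ?thesis .
  qed
  have "Inf_fin (range z) = x"
  proof (rule antisym)
    show "x \<le> Inf_fin (range z)"
      by (rule Inf_fin.boundedI) (use z in auto)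
    show "Inf_fin (range z) \<le> x"
    proof (rule le_funI)
      fix j
      have "Inf_fin (range z) \<le> z j"
        by (rule Inf_fin.coboundedI) auto
      then show "Inf_fin (range z) j \<le> x j"
        using z[of j] by (metis le_funD)
    qed
  qed
  moreover have "y l \<in> P \<and> y l \<noteq> x \<and> (\<exists>j. y l j = x j)" if "l \<in> {1..n + 1}" for l
  proof -
    have "y l \<in> range z"
      using that im by blast
    then obtain j where "y l = z j"
      by blast
    then show ?thesis
      using z[of j] by metis
  qed
  ultimately have "n + 1 \<ge> 2 \<and> (\<forall>l\<in>{1..n + 1}. y l \<in> P \<and> y l \<noteq> x \<and> (\<exists>j. y l j = x j)) \<and>
      x = Inf_fin (y ` {1..n + 1})"
    unfolding im using n by simp
  with x show "x \<in> redundant_positions r P"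
    unfolding redundant_positions_def by blast
qed

lemma redundant_positions_mono:
  "P \<subseteq> A \<Longrightarrow> redundant_positions r P \<subseteq> redundant_positions r A"
  unfolding redundant_positions_iff subset_iff by meson

text \<open>
  A redundant dot on a face has another dot of the same face above it, so the maximal dots of a
  face survive the removal of all redundant dots.
\<close>

lemma has_dot_on_face_remove_redundant:
  fixes A :: "'m::finite pos set"
  assumes A: "A \<subseteq> grid r"
  shows "has_dot_on_face (A - redundant_positions r A) a j \<longleftrightarrow> has_dot_on_face A a j"
proof
  assume "has_dot_on_face A a j"
  then obtain y where y: "y \<in> {y \<in> A. a \<le> y \<and> y j = a j}"
    by (auto simp: has_dot_on_face_def)
  have "finite {y \<in> A. a \<le> y \<and> y j = a j}"
    using finite_subset[OF A finite_grid] by simp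
  then obtain m where m: "m \<in> A" "a \<le> m" "m j = a j"
    and max: "\<And>b. b \<in> A \<Longrightarrow> a \<le> b \<Longrightarrow> b j = a j \<Longrightarrow> m \<le> b \<Longrightarrow> m = b"
    using finite_has_maximal2[OF _ y] by auto
  have "m \<notin> redundant_positions r A"
  proof
    assume "m \<in> redundant_positions r A"
    then obtain z where "z \<in> A" "m \<le> z" "z \<noteq> m" "z j = m j"
      unfolding redundant_positions_iff by blast
    with max[of z] m show False by (auto intro: order_trans)
  qed
  with m show "has_dot_on_face (A - redundant_positions r A) a j"
    by (auto simp: has_dot_on_face_def)
qed (auto simp: has_dot_on_face_def)


section \<open>From permutation arrays to matricubes\<close>

lemma rank_fun_of_array_eq:
  fixes P :: "'m::finite pos set"
  assumes "totally_rankable r P" "a \<in> grid r"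
  shows "rank_fun_of_array r P a = int r + 1 - int (coord_rank j (upper_subarray P a))"
  using assms array_rank_eq_coord_rank[of "upper_subarray P a" j]
  by (simp add: totally_rankable_def rank_fun_of_array_def)

text \<open>
  Total rankability enters through the free choice of the coordinate in which the rank is computed:
  for a step in direction \<open>j\<close> it is computed in direction \<open>j\<close>.
\<close>

lemma rank_fun_of_array_step:
  fixes P :: "'m::finite pos set"
  assumes P: "P \<subseteq> grid r" and T: "totally_rankable r P" and a: "a \<in> grid r" "a j < r"
  shows "rank_fun_of_array r P (a(j := a j + 1)) =
           rank_fun_of_array r P a + (if has_dot_on_face P a j then 1 else 0)"
proof -
  have "a(j := a j + 1) \<in> grid r"
    using a step_in_grid_iff by blast
  then show ?thesis
    using rank_fun_of_array_eq[OF T, of _ j] coord_rank_step[OF P, of j a] a by simp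
qed

lemma rank_fun_of_array_mono:
  fixes P :: "'m::finite pos set"
  assumes P: "P \<subseteq> grid r" and T: "totally_rankable r P"
    and xy: "x \<in> grid r" "y \<in> grid r" "x \<le> y"
  shows "rank_fun_of_array r P x \<le> rank_fun_of_array r P y"
  using rank_fun_of_array_eq[OF T xy(1)] rank_fun_of_array_eq[OF T xy(2)]
    coord_rank_upper_subarray_antimono[OF P xy(3)]
  by (metis diff_left_mono of_nat_le_iff)

lemma rank_fun_of_array_submodular:
  fixes P :: "'m::finite pos set"
  assumes P: "P \<subseteq> grid r" and T: "totally_rankable r P"
    and "x \<in> grid r" "y \<in> grid r"
  shows "rank_fun_of_array r P (sup x y) + rank_fun_of_array r P (inf x y)
           \<le> rank_fun_of_array r P x + rank_fun_of_array r P y"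
proof (rule submodular_of_diminishing_increments[OF rank_fun_of_array_mono[OF P T] _ assms(3,4)])
  fix a b :: "'m pos" and i
  assume ab: "a \<in> grid r" "b \<in> grid r" "a \<le> b" "a i = b i" "b i < r"
  then show "rank_fun_of_array r P (b(i := b i + 1)) - rank_fun_of_array r P b
      \<le> rank_fun_of_array r P (a(i := a i + 1)) - rank_fun_of_array r P a"
    using rank_fun_of_array_step[OF P T, of a i] rank_fun_of_array_step[OF P T, of b i]
      has_dot_on_face_antimono[of P b i a] by (simp del: fun_upd_apply)
qed

lemma coord_values_of_full_rank:
  assumes P: "P \<subseteq> grid r" and "coord_rank j P = r + 1"
  shows "{t. \<exists>y\<in>P. y j = t} = {..r}"
proof (rule card_subset_eq)
  show "{t. \<exists>y\<in>P. y j = t} \<subseteq> {..r}"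
    using P by (auto simp: grid_def)
  show "card {t. \<exists>y\<in>P. y j = t} = card {..r}"
    using assms(2) by (simp add: coord_rank_def)
qed simp

lemma full_coord_rank_of_permutation_array:
  assumes "permutation_array r P"
  shows "coord_rank j P = r + 1"
proof -
  have "rankable P"
    using assms zero_in_grid upper_subarray_zero
    unfolding permutation_array_def totally_rankable_def by metis
  then show ?thesis
    using assms array_rank_eq_coord_rank by (metis permutation_array_def)
qed

lemma rank_fun_of_array_axis:
  fixes P :: "'m::finite pos set"
  assumes perm: "permutation_array r P" and t: "t \<le> r"
  shows "rank_fun_of_array r P ((\<lambda>_. 0)(i := t)) = int t"
proof -
  have P: "P \<subseteq> grid r" and T: "totally_rankable r P"
    using perm by (auto simp: permutation_array_def)
  let ?a = "(\<lambda>_. 0)(i := t) :: 'm pos"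
  have full: "{s. \<exists>y\<in>P. y i = s} = {..r}"
    by (rule coord_values_of_full_rank[OF P full_coord_rank_of_permutation_array[OF perm]])
  have le: "?a \<le> y \<longleftrightarrow> t \<le> y i" for y
    by (auto simp: le_fun_def)
  have "{s. \<exists>y\<in>upper_subarray P ?a. y i = s} = {s. \<exists>y\<in>P. y i = s} \<inter> {t..}"
    by (auto simp: upper_subarray_def le simp del: fun_upd_apply)
  also have "\<dots> = {t..r}"
    unfolding full by auto
  finally have "coord_rank i (upper_subarray P ?a) = r + 1 - t"
    by (simp add: coord_rank_def)
  then show ?thesis
    using rank_fun_of_array_eq[OF T axis_in_grid[OF t], of i i] t by simp
qed

lemma simple_matricube_of_permutation_array:
  fixes P :: "'m::finite pos set"
  assumes perm: "permutation_array r P" and r: "r \<ge> 1"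
  shows "simple_matricube r (rank_fun_of_array r P)"
proof -
  have P: "P \<subseteq> grid r" and T: "totally_rankable r P"
    using perm by (auto simp: permutation_array_def)
  note axis = rank_fun_of_array_axis[OF perm]
  have "rank_fun_of_array r P (\<lambda>_. 0) = 0"
    using axis[of 0] by (simp add: fun_upd_idem)
  moreover have "\<forall>i. \<forall>t\<in>{1..r}. rank_fun_of_array r P ((\<lambda>_. 0)(i := t)) -
      rank_fun_of_array r P ((\<lambda>_. 0)(i := t - 1)) \<le> 1"
    using axis by (auto simp del: fun_upd_apply)
  ultimately show ?thesis
    using r axis rank_fun_of_array_mono[OF P T] rank_fun_of_array_submodular[OF P T]
    by (simp add: simple_matricube_def matricube_def del: fun_upd_apply)
qed

lemma matricube_rank_of_array:
  fixes P :: "'m::finite pos set"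
  assumes "P \<subseteq> grid r" "totally_rankable r P"
  shows "matricube_rank r (rank_fun_of_array r P) = (if top_pos r \<in> P then int r else int r + 1)"
  using rank_fun_of_array_eq[OF assms(2) top_pos_in_grid] coord_rank_upper_subarray_top[OF assms(1)]
  by (simp add: matricube_rank_def)

lemma flats_of_array_iff:
  fixes P :: "'m::finite pos set"
  assumes P: "P \<subseteq> grid r" and T: "totally_rankable r P"
  shows "a \<in> flats r (rank_fun_of_array r P) \<longleftrightarrow>
           a \<in> grid r \<and> (\<forall>i. a i < r \<longrightarrow> has_dot_on_face P a i)"
proof (cases "a \<in> grid r")
  case True
  then show ?thesis
    using rank_fun_of_array_step[OF P T True] step_in_grid_iff[OF True]
    by (force simp: flats_def simp del: fun_upd_apply split: if_splits)
qed (simp add: flats_def)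

text \<open>
  The point is that an undotted flat \<open>a\<close> other than the top also has dots on its faces in the
  directions with \<open>a\<^sub>i = r\<close>, about which the rank function says nothing: any dot above \<open>a\<close> lies
  on all of these faces, and there is one on the face in a direction with smaller coordinate.
\<close>

lemma flats_of_array:
  fixes P :: "'m::finite pos set"
  assumes P: "P \<subseteq> grid r" and T: "totally_rankable r P"
  shows "flats r (rank_fun_of_array r P) = P \<union> redundant_positions r P \<union> {top_pos r}"
proof (intro equalityI subsetI)
  fix a
  assume "a \<in> flats r (rank_fun_of_array r P)"
  then have a: "a \<in> grid r" and dots: "\<And>i. a i < r \<Longrightarrow> has_dot_on_face P a i"
    unfolding flats_of_array_iff[OF P T] by auto
  show "a \<in> P \<union> redundant_positions r P \<union> {top_pos r}"
  proof (rule ccontr)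
    assume neg: "\<not> ?thesis"
    then obtain i where i: "a i < r"
      using a grid_ne_topE by blast
    obtain y where y: "y \<in> P" "a \<le> y" "y i = a i"
      using dots[OF i] by (auto simp: has_dot_on_face_def)
    have "\<exists>z\<in>P. a \<le> z \<and> z \<noteq> a \<and> z j = a j" for j
    proof (cases "a j < r")
      case True
      then show ?thesis
        using dots[of j] neg by (auto simp: has_dot_on_face_def)
    next
      case False
      have "a j \<le> y j" "y j \<le> r"
        using y P by (auto simp: le_fun_def grid_def)
      then have "y j = a j"
        using False by simp
      then show ?thesis
        using y neg by auto
    qed
    with a neg show False
      by (simp add: redundant_positions_iff)
  qed
next
  fix a
  assume "a \<in> P \<union> redundant_positions r P \<union> {top_pos r}"
  then consider "a \<in> P" | "a \<in> redundant_positions r P" | "a = top_pos r"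
    by blast
  then show "a \<in> flats r (rank_fun_of_array r P)"
  proof cases
    case 1
    then show ?thesis
      using P by (auto simp: flats_of_array_iff[OF P T] has_dot_on_face_def)
  next
    case 2
    then show ?thesis
      unfolding redundant_positions_iff flats_of_array_iff[OF P T] has_dot_on_face_def by blast
  next
    case 3
    then show ?thesis
      by (simp add: flats_of_array_iff[OF P T] top_pos_in_grid) (simp add: top_pos_def)
  qed
qed


section \<open>From matricubes to permutation arrays\<close>

lemma matricube_mono:
  "matricube r \<rho> \<Longrightarrow> x \<in> grid r \<Longrightarrow> y \<in> grid r \<Longrightarrow> x \<le> y \<Longrightarrow> \<rho> x \<le> \<rho> y"
  by (simp add: matricube_def)

lemma matricube_increments_diminish:
  fixes a b :: "'m::finite pos"
  assumes M: "matricube r \<rho>" and ab: "b \<in> grid r" "a \<le> b" "a i = b i" "b i < r"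
  shows "\<rho> (b(i := b i + 1)) - \<rho> b \<le> \<rho> (a(i := a i + 1)) - \<rho> a"
proof -
  let ?a = "a(i := a i + 1)"
  have "a \<in> grid r"
    using ab in_grid_le by blast
  then have "?a \<in> grid r"
    using ab step_in_grid_iff by metis
  then have "\<rho> ?a + \<rho> b \<ge> \<rho> (sup ?a b) + \<rho> (inf ?a b)"
    using M ab(1) by (simp add: matricube_def del: fun_upd_apply)
  moreover have "sup ?a b = b(i := b i + 1)" "inf ?a b = a"
    using ab by (auto simp: fun_eq_iff le_fun_def sup_nat_def inf_nat_def)
  ultimately show ?thesis by simp
qed

lemma matricube_step_bounds:
  fixes a :: "'m::finite pos"
  assumes M: "matricube r \<rho>" and a: "a \<in> grid r" "a i < r"
  shows "\<rho> a \<le> \<rho> (a(i := a i + 1))" "\<rho> (a(i := a i + 1)) \<le> \<rho> a + 1"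
proof -
  show "\<rho> a \<le> \<rho> (a(i := a i + 1))"
    using step_in_grid_iff[OF a(1), of i] a by (intro matricube_mono[OF M]) (auto simp: le_fun_def)
  let ?o = "(\<lambda>_. 0)(i := a i) :: 'm pos"
  have "\<rho> (a(i := a i + 1)) - \<rho> a \<le> \<rho> (?o(i := ?o i + 1)) - \<rho> ?o"
    by (rule matricube_increments_diminish[OF M a(1)]) (use a in \<open>auto simp: le_fun_def\<close>)
  also have "\<dots> \<le> 1"
  proof -
    have "\<forall>t\<in>{1..r}. \<rho> ((\<lambda>_. 0)(i := t)) - \<rho> ((\<lambda>_. 0)(i := t - 1)) \<le> 1"
      using M by (simp add: matricube_def)
    from bspec[OF this, of "a i + 1"] show ?thesis using a(2) by simp
  qed
  finally show "\<rho> (a(i := a i + 1)) \<le> \<rho> a + 1" by simp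
qed

text \<open>
  The closure of \<open>a\<close>: at a maximal position above \<open>a\<close> with the value of \<open>\<rho>\<close> at \<open>a\<close>, every
  step must increase \<open>\<rho>\<close>.
\<close>

lemma flat_above:
  fixes a :: "'m::finite pos"
  assumes M: "matricube r \<rho>" and a: "a \<in> grid r"
  obtains y where "y \<in> flats r \<rho>" "a \<le> y" "\<rho> y = \<rho> a"
proof -
  let ?S = "{y \<in> grid r. a \<le> y \<and> \<rho> y = \<rho> a}"
  have "finite ?S" "a \<in> ?S"
    using finite_grid[of r] a by auto
  then obtain y where y: "y \<in> grid r" "a \<le> y" "\<rho> y = \<rho> a"
    and max: "\<And>z. z \<in> ?S \<Longrightarrow> y \<le> z \<Longrightarrow> y = z"
    using finite_has_maximal2[of ?S a] by auto
  have "\<rho> (y(i := y i + 1)) = \<rho> y + 1" if "y(i := y i + 1) \<in> grid r" for i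
  proof -
    let ?z = "y(i := y i + 1)"
    have "y \<le> ?z"
      by (simp add: le_fun_def)
    moreover have "y \<noteq> ?z"
      by (metis fun_upd_same n_not_Suc_n Suc_eq_plus1)
    ultimately have "\<rho> ?z \<noteq> \<rho> a"
      using max[of ?z] that order_trans[OF y(2)] by blast
    moreover have "y i < r"
      using that step_in_grid_iff[OF y(1)] by blast
    ultimately show ?thesis
      using matricube_step_bounds[OF M y(1), of i] y(3) by linarith
  qed
  then have "y \<in> flats r \<rho>"
    using y by (simp add: flats_def del: fun_upd_apply)
  then show ?thesis
    using that y by blast
qed

lemma array_of_matricube_subset_flats: "array_of_matricube r \<rho> \<subseteq> flats r \<rho>"
  using top_pos_in_grid[of r]
  by (auto simp: array_of_matricube_def flats_def grid_def top_pos_def split: if_splits)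

lemma flats_subset_grid: "flats r \<rho> \<subseteq> grid r"
  by (auto simp: flats_def)

lemma flats_step: "y \<in> flats r \<rho> \<Longrightarrow> y i < r \<Longrightarrow> \<rho> (y(i := y i + 1)) = \<rho> y + 1"
  using step_in_grid_iff[of y r i] by (auto simp: flats_def simp del: fun_upd_apply)

lemma matricube_step_iff_dot:
  fixes a :: "'m::finite pos"
  assumes M: "matricube r \<rho>" and a: "a \<in> grid r" "a j < r"
  shows "\<rho> (a(j := a j + 1)) =
           \<rho> a + (if has_dot_on_face (array_of_matricube r \<rho>) a j then 1 else 0)"
proof -
  let ?A = "array_of_matricube r \<rho>" and ?a = "a(j := a j + 1)"
  have "\<rho> ?a > \<rho> a" if "has_dot_on_face ?A a j"
  proof -
    obtain y where y: "y \<in> flats r \<rho>" "a \<le> y" "y j = a j"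
      using \<open>has_dot_on_face ?A a j\<close> array_of_matricube_subset_flats
      unfolding has_dot_on_face_def by blast
    have "\<rho> (y(j := y j + 1)) - \<rho> y \<le> \<rho> ?a - \<rho> a"
      using y a flats_subset_grid by (intro matricube_increments_diminish[OF M]) auto
    then show ?thesis
      using flats_step[OF y(1), of j] y(3) a(2) by simp
  qed
  moreover have "has_dot_on_face ?A a j" if "\<rho> ?a > \<rho> a"
  proof -
    obtain y where y: "y \<in> flats r \<rho>" "a \<le> y" "\<rho> y = \<rho> a"
      using flat_above[OF M a(1)] .
    have "y j = a j"
    proof (rule ccontr)
      assume "y j \<noteq> a j"
      then have "?a \<le> y"
        using y(2) step_le_iff by blast
      moreover have "?a \<in> grid r" "y \<in> grid r"
        using y flats_subset_grid step_in_grid_iff[OF a(1)] a(2) by blast+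
      ultimately have "\<rho> ?a \<le> \<rho> y"
        using matricube_mono[OF M] by blast
      with that y(3) show False by simp
    qed
    moreover from this have "y \<noteq> top_pos r"
      using a(2) by (auto simp: top_pos_def)
    ultimately show ?thesis
      using y unfolding has_dot_on_face_def array_of_matricube_def by blast
  qed
  ultimately have "has_dot_on_face ?A a j \<longleftrightarrow> \<rho> ?a > \<rho> a"
    by blast
  then show ?thesis
    using matricube_step_bounds[OF M a] by (simp del: fun_upd_apply)
qed

text \<open>
  On the boundary \<open>a\<^sub>j = r\<close>, simplicity and the rank hypothesis leave only the values \<open>r\<close> and
  \<open>r + 1\<close>. Above a position of value \<open>r + 1\<close>, a flat other than the top would push the
  rank beyond \<open>r + 1\<close>, and the top is undotted; a position of value \<open>r\<close> lies below a dotted flat, which is the top precisely in the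
  case of rank \<open>r\<close>.
\<close>

lemma matricube_boundary_iff_dot:
  fixes a :: "'m::finite pos"
  assumes S: "simple_matricube r \<rho>"
    and rank: "matricube_rank r \<rho> = int r \<or> matricube_rank r \<rho> = int r + 1"
    and a: "a \<in> grid r" "a j = r"
  shows "\<rho> a = int r + 1 - (if has_dot_on_face (array_of_matricube r \<rho>) a j then 1 else 0)"
proof -
  let ?A = "array_of_matricube r \<rho>"
  have M: "matricube r \<rho>"
    using S by (simp add: simple_matricube_def)
  have "\<rho> ((\<lambda>_. 0)(j := r)) = int r"
    using S by (simp add: simple_matricube_def)
  moreover have "\<rho> ((\<lambda>_. 0)(j := r)) \<le> \<rho> a"
    using a by (intro matricube_mono[OF M]) (auto simp: grid_def le_fun_def)
  ultimately have ge: "int r \<le> \<rho> a" by simp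
  have le: "\<rho> x \<le> matricube_rank r \<rho>" if "x \<in> grid r" for x
    unfolding matricube_rank_def
    using that by (intro matricube_mono[OF M] top_pos_in_grid grid_le_top_pos)
  have top_dotted: "top_pos r \<in> ?A \<longleftrightarrow> matricube_rank r \<rho> = int r"
    by (simp add: array_of_matricube_def)
  have "\<rho> a = int r" if "has_dot_on_face ?A a j"
  proof -
    obtain y where y: "y \<in> ?A" "a \<le> y"
      using \<open>has_dot_on_face ?A a j\<close> unfolding has_dot_on_face_def by blast
    have yf: "y \<in> flats r \<rho>"
      using y(1) array_of_matricube_subset_flats by blast
    then have yg: "y \<in> grid r"
      using flats_subset_grid by blast
    show ?thesis
    proof (cases "y = top_pos r")
      case True
      then show ?thesis
        using y(1) top_dotted le[OF a(1)] ge by simp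
    next
      case False
      then obtain i where i: "y i < r"
        using grid_ne_topE yg by blast
      have "\<rho> a \<le> \<rho> y"
        using matricube_mono[OF M a(1) yg y(2)] .
      moreover have "\<rho> (y(i := y i + 1)) = \<rho> y + 1"
        using flats_step[OF yf i] .
      moreover have "\<rho> (y(i := y i + 1)) \<le> matricube_rank r \<rho>"
        using le step_in_grid_iff[OF yg] i by blast
      ultimately show ?thesis
        using ge rank by linarith
    qed
  qed
  moreover have "has_dot_on_face ?A a j" if "\<rho> a = int r"
  proof -
    obtain y where y: "y \<in> flats r \<rho>" "a \<le> y" "\<rho> y = \<rho> a"
      using flat_above[OF M a(1)] .
    have "y j = a j"
      using y flats_subset_grid a(2) by (fastforce simp: grid_def le_fun_def intro: antisym)
    moreover have "y \<in> ?A"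
    proof (cases "y = top_pos r")
      case True
      then show ?thesis
        using y(3) that top_dotted by (simp add: matricube_rank_def)
    next
      case False
      then show ?thesis
        using y(1) by (simp add: array_of_matricube_def)
    qed
    ultimately show ?thesis
      using y(2) unfolding has_dot_on_face_def by blast
  qed
  ultimately have "has_dot_on_face ?A a j \<longleftrightarrow> \<rho> a = int r"
    by blast
  then show ?thesis
    using ge le[OF a(1)] rank by auto
qed

text \<open>
  The faces at \<open>a\<close>, \<open>a + e\<^sub>j\<close>, \<open>a + 2e\<^sub>j\<close>, and so on in direction \<open>j\<close> partition \<open>P[a]\<close>; adding up their
  contributions from the boundary downwards telescopes.
\<close>

lemma coord_rank_of_matricube_array:
  fixes a :: "'m::finite pos"
  assumes S: "simple_matricube r \<rho>"
    and rank: "matricube_rank r \<rho> = int r \<or> matricube_rank r \<rho> = int r + 1"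
    and P: "P = array_of_matricube r \<rho> - redundant_positions r (array_of_matricube r \<rho>)"
    and a: "a \<in> grid r"
  shows "int (coord_rank j (upper_subarray P a)) = int r + 1 - \<rho> a"
  using a
proof (induction "r - a j" arbitrary: a)
  case base: 0
  let ?A = "array_of_matricube r \<rho>"
  have A: "?A \<subseteq> grid r"
    using array_of_matricube_subset_flats flats_subset_grid by blast
  then have Pg: "P \<subseteq> grid r"
    using P by blast
  have aj: "a j = r"
    using base by (simp add: grid_def le_antisym)
  have "coord_rank j (upper_subarray P (a(j := a j + 1))) = 0"
    by (rule coord_rank_outside_grid[OF Pg]) (use aj in simp)
  then show ?case
    using coord_rank_step[OF Pg, of j a] matricube_boundary_iff_dot[OF S rank base(2) aj]
      has_dot_on_face_remove_redundant[OF A, of a j]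
    by (simp add: P)
next
  case step: (Suc n)
  let ?A = "array_of_matricube r \<rho>"
  have M: "matricube r \<rho>"
    using S by (simp add: simple_matricube_def)
  have A: "?A \<subseteq> grid r"
    using array_of_matricube_subset_flats flats_subset_grid by blast
  then have Pg: "P \<subseteq> grid r"
    using P by blast
  have aj: "a j < r"
    using step(2) by simp
  have "int (coord_rank j (upper_subarray P (a(j := a j + 1)))) = int r + 1 - \<rho> (a(j := a j + 1))"
    using step(2) step_in_grid_iff[OF step(3), of j] aj by (intro step(1)) auto
  then show ?case
    using coord_rank_step[OF Pg, of j a] matricube_step_iff_dot[OF M step(3) aj]
      has_dot_on_face_remove_redundant[OF A, of a j]
    by (simp add: P split: if_splits)
qed

lemma permutation_array_of_simple_matricube:
  fixes \<rho> :: "'m::finite pos \<Rightarrow> int"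
  assumes S: "simple_matricube r \<rho>"
    and rank: "matricube_rank r \<rho> = int r \<or> matricube_rank r \<rho> = int r + 1"
  shows "permutation_array r (array_of_matricube r \<rho> - redundant_positions r (array_of_matricube r \<rho>))"
proof -
  let ?A = "array_of_matricube r \<rho>"
  let ?P = "?A - redundant_positions r ?A"
  note count = coord_rank_of_matricube_array[OF S rank refl]
  have ranks: "rankable (upper_subarray ?P a)" if "a \<in> grid r" for a
    unfolding rankable_def using count[OF that] by (metis of_nat_eq_iff)
  have "rankable ?P"
    using ranks[OF zero_in_grid] by (simp add: upper_subarray_zero)
  moreover have "\<rho> (\<lambda>_. 0) = 0"
    using S by (simp add: simple_matricube_def matricube_def)
  then have "int (coord_rank j ?P) = int r + 1" for j
    using count[OF zero_in_grid, of j] by (simp add: upper_subarray_zero)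
  then have "coord_rank j ?P = r + 1" for j
    by (metis of_nat_Suc of_nat_eq_iff add.commute Suc_eq_plus1)
  ultimately have "array_rank ?P = r + 1"
    using array_rank_eq_coord_rank by metis
  moreover have "?P \<subseteq> grid r"
    using array_of_matricube_subset_flats flats_subset_grid by blast
  moreover have "?P \<inter> redundant_positions r ?P = {}"
    using redundant_positions_mono[of ?P ?A r] by blast
  ultimately show ?thesis
    using ranks by (simp add: permutation_array_def totally_rankable_def)
qed


section \<open>The correspondence\<close>

theorem theorem7p1:
  fixes r :: nat
  assumes "r \<ge> 1"
  shows
    "(\<forall>P :: 'm::finite pos set. permutation_array r P \<longrightarrow>
        simple_matricube r (rank_fun_of_array r P) \<and>
        (top_pos r \<in> P \<longrightarrow> matricube_rank r (rank_fun_of_array r P) = int r) \<and>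
        (top_pos r \<notin> P \<longrightarrow> matricube_rank r (rank_fun_of_array r P) = int r + 1) \<and>
        flats r (rank_fun_of_array r P) = P \<union> redundant_positions r P \<union> {top_pos r})
     \<and>
     (\<forall>\<rho> :: 'm pos \<Rightarrow> int.
        simple_matricube r \<rho> \<and>
        (matricube_rank r \<rho> = int r \<or> matricube_rank r \<rho> = int r + 1) \<longrightarrow>
        permutation_array r
          (array_of_matricube r \<rho> - redundant_positions r (array_of_matricube r \<rho>)))"
proof (intro conjI allI impI)
  fix P :: "'m pos set"
  assume perm: "permutation_array r P"
  then have P: "P \<subseteq> grid r" "totally_rankable r P"
    by (auto simp: permutation_array_def)
  show "simple_matricube r (rank_fun_of_array r P)"
    using simple_matricube_of_permutation_array[OF perm assms] .
  show "matricube_rank r (rank_fun_of_array r P) = int r" if "top_pos r \<in> P"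
    using matricube_rank_of_array[OF P] that by simp
  show "matricube_rank r (rank_fun_of_array r P) = int r + 1" if "top_pos r \<notin> P"
    using matricube_rank_of_array[OF P] that by simp
  show "flats r (rank_fun_of_array r P) = P \<union> redundant_positions r P \<union> {top_pos r}"
    using flats_of_array[OF P] .
next
  fix \<rho> :: "'m pos \<Rightarrow> int"
  assume "simple_matricube r \<rho> \<and>
    (matricube_rank r \<rho> = int r \<or> matricube_rank r \<rho> = int r + 1)"
  then show "permutation_array r
      (array_of_matricube r \<rho> - redundant_positions r (array_of_matricube r \<rho>))"
    using permutation_array_of_simple_matricube by blast
qed

end
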